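(* Let $\mathcal{I}=\{1,\dots,N\}$ be the set of agents with coupling graph $G=(\mathcal{I},E)$, behavior sets $\mathbb{M}_i$, local specification sets $S_i\subseteq\mathbb{M}_i$, global specification set $S\subseteq\mathbb{M}=\mathbb{M}_1\times\cdots\times\mathbb{M}_N$, and assumption sets $W_j^i$ ($i\in\mathcal{I}$, $j\in\mathcal{N}_i$). Suppose $S_i\neq\emptyset$ for every $i\in\mathcal{I}$, and let $P$ be a partition of $\mathcal{I}$ into coalitions. Let $\mathcal{C}:=(\mathbb{M},S)$ be the global contract and let $\mathcal{C}_C$, $C\in P$, be the coalition contracts. Then $$\bigotimes_{C\in P}\mathcal{C}_C\preceq\mathcal{C}$$ holds if and only if all three of the following conditions hold: (1) $S_j\subseteq W_j^C$ for every $C\in P$ and every $j\in\mathcal{N}_C$; (2) the directed graph $\Gamma_P$ is acyclic; (3) $\prod_{i\in\mathcal{I}}S_i\subseteq S$.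
   Context: Agents and behaviors. $\mathcal{I}=\{1,\dots,N\}$ is a finite set of agents and $T$ is a fixed finite horizon. Agent $i$ has input $u_i[t]\in\mathbb{R}^{m_i}$ and state $x_i[t]\in\mathbb{R}^{n_i}$; its behavior is $w_i=(u_i[0],\dots,u_i[T-1],x_i[0],\dots,x_i[T])$. $\mathbb{M}_i\subseteq\prod_{t=0}^{T-1}\mathbb{R}^{m_i}\times\prod_{t=0}^{T}\mathbb{R}^{n_i}$ is the given set of behaviors agent $i$ can realize (no particular dynamics is assumed). Network behaviors are $w=(w_1,\dots,w_N)\in\mathbb{M}:=\mathbb{M}_1\times\cdots\times\mathbb{M}_N$. Specifications. $S:=\{w\in\mathbb{M}\mid (w,0)\models\varphi\}$ for a given signal temporal logic (STL) formula $\varphi$ over network behaviors, and $S_i:=\{w_i\in\mathbb{M}_i\mid (w_i,0)\models\varphi_i\}$ for a given STL formula $\varphi_i$ over behaviors of agent $i$. STL formulas are built from predicates $p(w[t])\ge 0$ (with $p$ real-valued and $w[t]$ the vector of inputs and states at time $t$) by $\neg,\wedge,\vee$ and the time-bounded operators $F_{[a,b]}$ (eventually), $G_{[a,b]}$ (always), $U_{[a,b]}$ (until), with the usual discrete-time semantics; $(w,t)\models\varphi$ means that $w$ satisfies $\varphi$ at time $t$. The formulas $\varphi,\varphi_i$ enter the statement only through the sets $S\subseteq\mathbb{M}$ and $S_i\subseteq\mathbb{M}_i$. Graph, coalitions, partitions. $G=(\mathcal{I},E)$ is a simple undirected graph, $\mathcal{N}_i:=\{j\in\mathcal{I}\mid\{i,j\}\in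 E\}$. A coalition is a nonempty subset $C\subseteq\mathcal{I}$ inducing a connected subgraph of $G$; $\mathcal{N}_C:=(\bigcup_{i\in C}\mathcal{N}_i)\setminus C$. A partition is a family $P$ of pairwise disjoint coalitions whose union is $\mathcal{I}$. Contracts. A contract is a pair $(\mathcal{A},\mathcal{G})$ with $\mathcal{A},\mathcal{G}\subseteq\mathbb{M}$; it is saturated if $\mathcal{G}\supseteq\mathbb{M}\setminus\mathcal{A}$. All contracts here are saturated. $(\mathcal{A}_2,\mathcal{G}_2)\preceq(\mathcal{A}_1,\mathcal{G}_1)$ (refinement) means $\mathcal{A}_2\supseteq\mathcal{A}_1$ and $\mathcal{G}_2\subseteq\mathcal{G}_1$. The composition of a finite family of saturated contracts $(\mathcal{A}_l,\mathcal{G}_l)$, $l\in L$, is $\bigotimes_{l\in L}(\mathcal{A}_l,\mathcal{G}_l)=(\mathcal{A},\mathcal{G})$ with $\mathcal{G}=\bigcap_{l\in L}\mathcal{G}_l$ and $\mathcal{A}=\big(\bigcap_{l\in L}\mathcal{A}_l\big)\cup\big(\mathbb{M}\setminus\bigcap_{l\in L}\mathcal{G}_l\big)$. Assumptions and coalition contracts. For each $i\in\mathcal{I}$ and $j\in\mathcal{N}_i$, agent $i$ holds an assumption $W_j^i\subseteq\prod_{t=0}^{T-1}\mathbb{R}^{m_j}\times\prod_{t=0}^{T}\mathbb{R}^{n_j}$ (not necessarily contained in $\mathbb{M}_j$). For a coalition $C$ and $j\in\mathcal{N}_C$, $W_j^C:=\bigcap\{W_j^i\mid i\in C,\ j\in\mathcal{N}_i\}$.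 The contract of $C$ is $\mathcal{C}_C:=(\mathcal{A}_C,\hat{\mathcal{G}}_C)$, where $\mathcal{A}_C:=\{w\in\mathbb{M}\mid w_j\in W_j^C\ \forall j\in\mathcal{N}_C\}$, $\mathcal{G}_C:=\{w\in\mathbb{M}\mid w_i\in S_i\ \forall i\in C\}$, and $\hat{\mathcal{G}}_C:=\mathcal{G}_C\cup(\mathbb{M}\setminus\mathcal{A}_C)$. Assumption graph. For a partition $P$, $\Gamma_P:=(P,E_P)$ is the directed graph with vertex set $P$ and edge set $E_P:=\{(D,C)\mid C,D\in P,\ \exists j\in D\cap\mathcal{N}_C:\ \mathbb{M}_j\not\subseteq W_j^C\}$. Acyclic means having no directed cycle. *)

theory Defs
  imports Complex_Main "HOL-Library.FuncSet" "HOL-Library.Disjoint_Sets"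
begin

text \<open>
  The dimensions vary from agent to agent, so \<open>\<real>\<^sup>d\<close> is represented by the extensional functions
  \<open>{..<d} \<rightarrow>\<^sub>E UNIV\<close>. A behavior is a pair \<open>(u, x)\<close> of an input signal on times \<open>0, \<dots>, T - 1\<close> and a
  state signal on times \<open>0, \<dots>, T\<close>. Extensionality makes equality of behaviors coincide with equality
  of tuples; a network behavior is likewise an extensional function on the set of agents.
\<close>

type_synonym behavior = "(nat \<Rightarrow> nat \<Rightarrow> real) \<times> (nat \<Rightarrow> nat \<Rightarrow> real)"

definition real_space :: "nat \<Rightarrow> (nat \<Rightarrow> real) set" where
  "real_space d = {..<d} \<rightarrow>\<^sub>E UNIV"

definition behavior_space :: "nat \<Rightarrow> nat \<Rightarrow> nat \<Rightarrow> behavior set" where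
  "behavior_space T m n = ({..<T} \<rightarrow>\<^sub>E real_space m) \<times> ({..T} \<rightarrow>\<^sub>E real_space n)"

definition simple_graph :: "'i set \<Rightarrow> 'i set set \<Rightarrow> bool" where
  "simple_graph I E \<longleftrightarrow> (\<forall>e\<in>E. e \<subseteq> I \<and> card e = 2)"

definition neighbors :: "'i set set \<Rightarrow> 'i \<Rightarrow> 'i set" where
  "neighbors E i = {j. {i, j} \<in> E}"

definition induced_connected :: "'i set set \<Rightarrow> 'i set \<Rightarrow> bool" where
  "induced_connected E C \<longleftrightarrow>
     (\<forall>i\<in>C. \<forall>j\<in>C. (i, j) \<in> {(a, b). a \<in> C \<and> b \<in> C \<and> {a, b} \<in> E}\<^sup>*)"

definition coalition :: "'i set \<Rightarrow> 'i set set \<Rightarrow> 'i set \<Rightarrow> bool" where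
  "coalition I E C \<longleftrightarrow> C \<noteq> {} \<and> C \<subseteq> I \<and> induced_connected E C"

definition coalition_neighbors :: "'i set set \<Rightarrow> 'i set \<Rightarrow> 'i set" where
  "coalition_neighbors E C = (\<Union>i\<in>C. neighbors E i) - C"

definition coalition_partition :: "'i set \<Rightarrow> 'i set set \<Rightarrow> 'i set set \<Rightarrow> bool" where
  "coalition_partition I E P \<longleftrightarrow> partition_on I P \<and> (\<forall>C\<in>P. coalition I E C)"

type_synonym 'w contract = "'w set \<times> 'w set"

definition saturated :: "'w set \<Rightarrow> 'w contract \<Rightarrow> bool" where
  "saturated M c \<longleftrightarrow> fst c \<subseteq> M \<and> snd c \<subseteq> M \<and> M - fst c \<subseteq> snd c"

text \<open>\<open>contract_refines c\<^sub>2 c\<^sub>1\<close> stands for \<open>c\<^sub>2 \<preceq> c\<^sub>1\<close>.\<close>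

definition contract_refines :: "'w contract \<Rightarrow> 'w contract \<Rightarrow> bool" where
  "contract_refines c2 c1 \<longleftrightarrow> fst c1 \<subseteq> fst c2 \<and> snd c2 \<subseteq> snd c1"

text \<open>
  Composition of a family of saturated contracts over \<open>M\<close>. Intersecting with \<open>M\<close> matters only for
  the empty family, whose intersection is taken inside the universe \<open>M\<close>.
\<close>

definition compose_contracts :: "'w set \<Rightarrow> 'l set \<Rightarrow> ('l \<Rightarrow> 'w contract) \<Rightarrow> 'w contract" where
  "compose_contracts M L c =
     (let A = M \<inter> (\<Inter>l\<in>L. fst (c l)); G = M \<inter> (\<Inter>l\<in>L. snd (c l))
      in (A \<union> (M - G), G))"

text \<open>
  \<open>W i j\<close> is the assumption \<open>W\<^sub>j\<^sup>i\<close> that agent \<open>i\<close> holds about its neighbor \<open>j\<close>. The intersection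
  below is over a nonempty family whenever \<open>j\<close> is a neighbor of the coalition \<open>C\<close>.
\<close>

definition coalition_assm ::
  "'i set set \<Rightarrow> ('i \<Rightarrow> 'i \<Rightarrow> 'b set) \<Rightarrow> 'i set \<Rightarrow> 'i \<Rightarrow> 'b set" where
  "coalition_assm E W C j = \<Inter> {W i j | i. i \<in> C \<and> j \<in> neighbors E i}"

definition assumption_set ::
  "('i \<Rightarrow> 'b) set \<Rightarrow> 'i set set \<Rightarrow> ('i \<Rightarrow> 'i \<Rightarrow> 'b set) \<Rightarrow> 'i set \<Rightarrow> ('i \<Rightarrow> 'b) set" where
  "assumption_set M E W C =
     {w \<in> M. \<forall>j\<in>coalition_neighbors E C. w j \<in> coalition_assm E W C j}"

definition guarantee_set ::
  "('i \<Rightarrow> 'b) set \<Rightarrow> ('i \<Rightarrow> 'b set) \<Rightarrow> 'i set \<Rightarrow> ('i \<Rightarrow> 'b) set" where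
  "guarantee_set M S C = {w \<in> M. \<forall>i\<in>C. w i \<in> S i}"

definition coalition_contract ::
  "('i \<Rightarrow> 'b) set \<Rightarrow> 'i set set \<Rightarrow> ('i \<Rightarrow> 'i \<Rightarrow> 'b set) \<Rightarrow> ('i \<Rightarrow> 'b set) \<Rightarrow> 'i set
    \<Rightarrow> ('i \<Rightarrow> 'b) contract" where
  "coalition_contract M E W S C =
     (assumption_set M E W C, guarantee_set M S C \<union> (M - assumption_set M E W C))"

lemma saturated_coalition_contract: "saturated M (coalition_contract M E W S C)"
  by (auto simp: saturated_def coalition_contract_def assumption_set_def guarantee_set_def)

lemma saturated_global_contract: "S \<subseteq> M \<Longrightarrow> saturated M (M, S)"
  by (auto simp: saturated_def)

text \<open>Unlike above, \<open>M j\<close> is the behavior set of the single agent \<open>j\<close>.\<close>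

definition assumption_edges ::
  "('i \<Rightarrow> 'b set) \<Rightarrow> 'i set set \<Rightarrow> ('i \<Rightarrow> 'i \<Rightarrow> 'b set) \<Rightarrow> 'i set set \<Rightarrow> ('i set \<times> 'i set) set" where
  "assumption_edges M E W P =
     {(D, C). D \<in> P \<and> C \<in> P \<and>
        (\<exists>j \<in> D \<inter> coalition_neighbors E C. \<not> M j \<subseteq> coalition_assm E W C j)}"

end

theory Submission imports Defs begin

text \<open>
  Sufficiency: if \<open>w\<close> satisfies all guarantees, then \<open>w\<close> satisfies the assumptions of every coalition,
  by well-founded induction along the acyclic graph; hence \<open>w\<close> lies in \<open>\<Pi>\<^sub>E i\<in>I. S i\<close>. Necessity of
  acyclicity: a cycle in the graph, taken simple, gives for each of its coalitions \<open>C\<close> an agent \<open>j C\<close> in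
  the preceding coalition and a behavior of \<open>j C\<close> that violates the assumption of \<open>C\<close>. As the agents
  \<open>j C\<close> are distinct, these behaviors can be combined, with local specifications elsewhere, into one
  network behavior that violates all assumptions along the cycle and meets the specifications off it.
  It therefore satisfies all guarantees, although the composed assumption excludes it.
\<close>

lemma coalition_neighbors_subset:
  assumes "simple_graph I E"
  shows "coalition_neighbors E C \<subseteq> I"
  using assms by (auto simp: coalition_neighbors_def neighbors_def simple_graph_def)

text \<open>The global assumption is all of \<open>M\<close>, so the composed assumption must be all
  of \<open>M\<close> too: a behavior meeting every guarantee has to meet every assumption. Inside
  \<open>M\<close>, a saturated guarantee is just the implication from assumption to
  guarantee.\<close>

lemma contract_refines_compose_iff:
  "contract_refines (compose_contracts M P (coalition_contract M E W S)) (M, R) \<longleftrightarrow>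
     (\<forall>w\<in>M. (\<forall>C\<in>P. w \<in> assumption_set M E W C \<longrightarrow> w \<in> guarantee_set M S C) \<longrightarrow>
        (\<forall>C\<in>P. w \<in> assumption_set M E W C) \<and> w \<in> R)"
  unfolding contract_refines_def compose_contracts_def coalition_contract_def Let_def fst_conv snd_conv
  by blast

text \<open>The pair \<open>K\<close>, \<open>p\<close> plays the role of a simple cycle without any
  path bookkeeping. Choose a smallest nonempty set in which every element has a predecessor; a
  predecessor map sends it onto a subset with the same property, so by minimality that map is onto,
  hence injective.\<close>

lemma finite_not_acyclic_obtains_permutation:
  assumes "finite r" and "\<not> acyclic r"
  obtains K p where "K \<noteq> {}" "inj_on p K" "p ` K = K" "\<And>x. x \<in> K \<Longrightarrow> (p x, x) \<in> r"
proof -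
  define closed where "closed K \<longleftrightarrow> K \<noteq> {} \<and> (\<forall>z\<in>K. \<exists>y\<in>K. (y, z) \<in> r)" for K
  have "\<not> wf r"
    using assms(2) wf_acyclic by blast
  then have "\<exists>Q. closed Q"
    unfolding closed_def by (metis wfI_min empty_iff)
  then have "\<exists>K. closed K \<and> (\<forall>K'. closed K' \<longrightarrow> card K \<le> card K')"
    using ex_has_least_nat[of closed _ card] by metis
  then obtain K where K: "closed K" and min: "\<And>K'. closed K' \<Longrightarrow> card K \<le> card K'"
    by metis
  from K obtain p where p: "\<And>z. z \<in> K \<Longrightarrow> p z \<in> K \<and> (p z, z) \<in> r"
    unfolding closed_def by metis
  \<comment> \<open>\<open>card\<close> is 0 on infinite sets, so minimality of
    \<open>card K\<close> is informative only once \<open>K\<close> is known to be finite.\<close>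
  have "K \<subseteq> Range r"
    using p by blast
  then have "finite K"
    using assms(1) by (simp add: finite_Range finite_subset)
  have "closed (p ` K)"
    using K p unfolding closed_def by blast
  then have le: "card K \<le> card (p ` K)"
    by (rule min)
  have "p ` K \<subseteq> K"
    using p by blast
  then have pK: "p ` K = K"
    using \<open>finite K\<close> le by (intro card_seteq)
  have "inj_on p K"
    by (rule eq_card_imp_inj_on) (simp_all add: \<open>finite K\<close> pK)
  moreover have "K \<noteq> {}"
    using K by (simp add: closed_def)
  ultimately show ?thesis
    using that[of K p] pK p by blast
qed

lemma guarantees_imp_assumptions:
  assumes P: "partition_on I P" "finite P"
    and nb: "\<And>C. C \<in> P \<Longrightarrow> coalition_neighbors E C \<subseteq> I"
    and local_assm: "\<And>C j. C \<in> P \<Longrightarrow> j \<in> coalition_neighbors E C \<Longrightarrow> S j \<subseteq> coalition_assm E W C j"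
    and acyc: "acyclic (assumption_edges M E W P)"
    and w: "w \<in> (\<Pi>\<^sub>E i\<in>I. M i)"
    and guar: "\<And>C. C \<in> P \<Longrightarrow> w \<in> assumption_set (\<Pi>\<^sub>E i\<in>I. M i) E W C \<Longrightarrow>
      w \<in> guarantee_set (\<Pi>\<^sub>E i\<in>I. M i) S C"
    and "C \<in> P"
  shows "w \<in> assumption_set (\<Pi>\<^sub>E i\<in>I. M i) E W C"
proof -
  have "assumption_edges M E W P \<subseteq> P \<times> P"
    by (auto simp: assumption_edges_def)
  then have "wf (assumption_edges M E W P)"
    using P(2) acyc by (meson finite_SigmaI finite_acyclic_wf finite_subset)
  then show ?thesis
    using \<open>C \<in> P\<close>
  proof (induction C rule: wf_induct_rule)
    case (less C)
    have "w j \<in> coalition_assm E W C j" if j: "j \<in> coalition_neighbors E C" for j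
    \<comment> \<open>The split is the edge condition. With no violating behavior of
      \<open>j\<close>, membership in \<open>M j\<close> suffices; otherwise the block
      \<open>D\<close> of \<open>j\<close> precedes \<open>C\<close>, its assumption holds by
      induction, and its guarantee puts \<open>w j\<close> in \<open>S j\<close>.\<close>
    proof (cases "M j \<subseteq> coalition_assm E W C j")
      case True
      then show ?thesis
        using w nb[OF less.prems] j by blast
    next
      case False
      obtain D where D: "D \<in> P" "j \<in> D"
        using nb[OF less.prems] j partition_onD1[OF P(1)] by blast
      then have "(D, C) \<in> assumption_edges M E W P"
        using False j less.prems by (auto simp: assumption_edges_def)
      then have "w j \<in> S j"
        using guar[OF D(1)] less.IH D by (auto simp: guarantee_set_def)
      then show ?thesis
        using local_assm[OF less.prems j] by blast
    qed
    then show ?case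
      using w by (simp add: assumption_set_def)
  qed
qed

text \<open>Coalitions in \<open>K\<close> meet their saturated guarantee because their assumption
  fails, the others because all their agents follow \<open>S\<close>. The resulting \<open>w\<close>
  refutes the right-hand side of \<open>contract_refines_compose_iff\<close>.\<close>

lemma not_acyclic_obtains_violation:
  assumes P: "partition_on I P" "finite P"
    and SM: "\<And>i. i \<in> I \<Longrightarrow> S i \<subseteq> M i"
    and ne: "\<And>i. i \<in> I \<Longrightarrow> S i \<noteq> {}"
    and cyc: "\<not> acyclic (assumption_edges M E W P)"
  obtains w C where "w \<in> (\<Pi>\<^sub>E i\<in>I. M i)" "C \<in> P" "w \<notin> assumption_set (\<Pi>\<^sub>E i\<in>I. M i) E W C"
    "\<And>C. C \<in> P \<Longrightarrow> w \<in> assumption_set (\<Pi>\<^sub>E i\<in>I. M i) E W C \<Longrightarrow>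
      w \<in> guarantee_set (\<Pi>\<^sub>E i\<in>I. M i) S C"
proof -
  have "assumption_edges M E W P \<subseteq> P \<times> P"
    by (auto simp: assumption_edges_def)
  then have "finite (assumption_edges M E W P)"
    using P(2) by (meson finite_SigmaI finite_subset)
  then obtain K p where K: "K \<noteq> {}" and inj: "inj_on p K" and pK: "p ` K = K"
    and edge: "\<And>C. C \<in> K \<Longrightarrow> (p C, C) \<in> assumption_edges M E W P"
    using finite_not_acyclic_obtains_permutation[OF _ cyc] by metis
  have KP: "C \<in> P" "p C \<in> P" if "C \<in> K" for C
    using edge[OF that] by (auto simp: assumption_edges_def)
  have "\<forall>C\<in>K. \<exists>j b. j \<in> p C \<and> j \<in> coalition_neighbors E C \<and> b \<in> M j \<and> b \<notin> coalition_assm E W C j"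
  proof
    fix C assume "C \<in> K"
    from edge[OF this] show "\<exists>j b. j \<in> p C \<and> j \<in> coalition_neighbors E C \<and> b \<in> M j \<and> b \<notin> coalition_assm E W C j"
      unfolding assumption_edges_def by blast
  qed
  then obtain j b where jp: "\<And>C. C \<in> K \<Longrightarrow> j C \<in> p C"
    and jn: "\<And>C. C \<in> K \<Longrightarrow> j C \<in> coalition_neighbors E C"
    and bM: "\<And>C. C \<in> K \<Longrightarrow> b C \<in> M (j C)"
    and bW: "\<And>C. C \<in> K \<Longrightarrow> b C \<notin> coalition_assm E W C (j C)"
    by metis
  have same: "C = D" if "C \<in> P" "D \<in> P" "i \<in> C" "i \<in> D" for C D i
    using partition_onD2[OF P(1)] that by (auto simp: disjoint_def)
  \<comment> \<open>If \<open>j C = j D\<close>, the blocks \<open>p C\<close> and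
    \<open>p D\<close> share an agent, so they coincide, and injectivity of \<open>p\<close> gives
    \<open>C = D\<close>. Hence no agent is asked to show two different violations, and
    \<open>inv_into K j\<close> below recovers the violated coalition.\<close>
  have injj: "inj_on j K"
    by (rule inj_onI) (metis inj inj_onD jp KP(2) same)
  obtain s where s: "\<And>i. i \<in> I \<Longrightarrow> s i \<in> S i"
    using that[of "\<lambda>i. SOME x. x \<in> S i"] ne by (simp add: some_in_eq)
  define w where "w = (\<lambda>i\<in>I. if i \<in> j ` K then b (inv_into K j i) else s i)"
  have jI: "j C \<in> I" if "C \<in> K" for C
    using jp[OF that] KP(2)[OF that] partition_onD1[OF P(1)] by blast
  have wj: "w (j C) = b C" if "C \<in> K" for C
    using that jI injj by (simp add: w_def)
  have ws: "w i = s i" if "i \<in> I" "i \<notin> j ` K" for i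
    using that by (simp add: w_def)
  have wM: "w \<in> (\<Pi>\<^sub>E i\<in>I. M i)"
  proof (rule PiE_I)
    fix i assume "i \<in> I"
    show "w i \<in> M i"
    proof (cases "i \<in> j ` K")
      case True
      then show ?thesis using wj bM by auto
    next
      case False
      then show ?thesis using ws s SM \<open>i \<in> I\<close> by (metis subsetD)
    qed
  qed (simp add: w_def)
  have viol: "w \<notin> assumption_set (\<Pi>\<^sub>E i\<in>I. M i) E W C" if "C \<in> K" for C
    using jn[OF that] bW[OF that] wj[OF that] unfolding assumption_set_def by force
  have "w \<in> guarantee_set (\<Pi>\<^sub>E i\<in>I. M i) S C" if C: "C \<in> P" "C \<notin> K" for C
  proof -
    have "w i \<in> S i" if "i \<in> C" for i
    proof -
      have "i \<in> I"
        using that C partition_onD1[OF P(1)] by blast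
      \<comment> \<open>Each \<open>j D\<close> lies in the block \<open>p D\<close>, which is again
        in \<open>K\<close>, so it cannot lie in the block \<open>C\<close> outside
        \<open>K\<close>.\<close>
      moreover have "i \<notin> j ` K"
        using same[OF C(1)] KP(2) jp pK C(2) that by blast
      ultimately show ?thesis
        using ws s by simp
    qed
    then show ?thesis
      using wM by (simp add: guarantee_set_def)
  qed
  with K that[OF wM] viol KP(1) show ?thesis
    by blast
qed

theorem composition_refines_global_iff:
  fixes M S_loc :: "'i \<Rightarrow> 'b set"
  assumes fin: "finite I"
    and graph: "simple_graph I E"
    and SM: "\<And>i. i \<in> I \<Longrightarrow> S_loc i \<subseteq> M i"
    and ne: "\<And>i. i \<in> I \<Longrightarrow> S_loc i \<noteq> {}"
    and part: "partition_on I P"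
  defines "MM \<equiv> (\<Pi>\<^sub>E i\<in>I. M i)"
  shows "contract_refines (compose_contracts MM P (coalition_contract MM E W S_loc)) (MM, S) \<longleftrightarrow>
      (\<forall>C\<in>P. \<forall>j\<in>coalition_neighbors E C. S_loc j \<subseteq> coalition_assm E W C j) \<and>
      acyclic (assumption_edges M E W P) \<and>
      (\<Pi>\<^sub>E i\<in>I. S_loc i) \<subseteq> S"
    (is "?refines \<longleftrightarrow> ?local \<and> ?acyclic \<and> ?product")
proof
  note nb = coalition_neighbors_subset[OF graph]
  have PI: "i \<in> I" if "i \<in> C" "C \<in> P" for i C
    using that partition_onD1[OF part] by blast
  have finP: "finite P"
    using finite_elements[OF fin part] .
  {
    assume ?refines
    then have ref: "(\<forall>C\<in>P. w \<in> assumption_set MM E W C) \<and> w \<in> S"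
      if "w \<in> MM" "\<And>C. C \<in> P \<Longrightarrow> w \<in> assumption_set MM E W C \<Longrightarrow> w \<in> guarantee_set MM S_loc C" for w
      using that unfolding contract_refines_compose_iff by blast
    \<comment> \<open>Points of the product meet every guarantee outright. The first conjunct will
      give \<open>?local\<close>, the second is \<open>?product\<close>.\<close>
    have prod: "(\<forall>C\<in>P. w \<in> assumption_set MM E W C) \<and> w \<in> S" if w: "w \<in> (\<Pi>\<^sub>E i\<in>I. S_loc i)" for w
    proof (rule ref)
      show "w \<in> MM"
        using w SM unfolding MM_def by (metis PiE_mono subsetD)
      then show "w \<in> guarantee_set MM S_loc C" if "C \<in> P" for C
        using w PI[OF _ that] by (auto simp: guarantee_set_def)
    qed
    have ?local
    proof (intro ballI subsetI)
      fix C j x assume C: "C \<in> P" and j: "j \<in> coalition_neighbors E C" and x: "x \<in> S_loc j"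
      \<comment> \<open>Nonempty local specifications supply the other coordinates, so that any
        single \<open>x\<close> in \<open>S_loc j\<close> occurs in a point of the product.\<close>
      obtain s where s: "s \<in> (\<Pi>\<^sub>E i\<in>I. S_loc i)"
        using ne by (metis PiE_eq_empty_iff ex_in_conv)
      have "s(j := x) \<in> (\<Pi>\<^sub>E i\<in>I. S_loc i)"
        using s x j nb by (auto simp: PiE_iff extensional_def)
      from prod[OF this] C j show "x \<in> coalition_assm E W C j"
        by (force simp: assumption_set_def)
    qed
    moreover have ?acyclic
    proof (rule ccontr)
      assume "\<not> ?acyclic"
      with part finP SM ne obtain w C where "w \<in> MM" "C \<in> P" "w \<notin> assumption_set MM E W C"
        "\<And>C. C \<in> P \<Longrightarrow> w \<in> assumption_set MM E W C \<Longrightarrow> w \<in> guarantee_set MM S_loc C"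
        unfolding MM_def by (rule not_acyclic_obtains_violation) blast+
      then show False
        using ref by blast
    qed
    ultimately show "?local \<and> ?acyclic \<and> ?product"
      using prod by blast
  }
  assume conds: "?local \<and> ?acyclic \<and> ?product"
  show ?refines
    unfolding contract_refines_compose_iff
  proof (intro ballI impI)
    fix w
    assume w: "w \<in> MM"
      and guar: "\<forall>C\<in>P. w \<in> assumption_set MM E W C \<longrightarrow> w \<in> guarantee_set MM S_loc C"
    have assm: "w \<in> assumption_set MM E W C" if "C \<in> P" for C
      unfolding MM_def
      by (rule guarantees_imp_assumptions[where S = S_loc, OF part finP nb])
        (use conds w guar that in \<open>auto simp: MM_def\<close>)
    have "w i \<in> S_loc i" if i: "i \<in> I" for i
    proof -
      obtain C where "C \<in> P" "i \<in> C"
        using i partition_onD1[OF part] by blast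
      then show ?thesis
        using assm[OF \<open>C \<in> P\<close>] guar unfolding guarantee_set_def by blast
    qed
    then have "w \<in> (\<Pi>\<^sub>E i\<in>I. S_loc i)"
      using w by (auto simp: MM_def PiE_iff)
    then show "(\<forall>C\<in>P. w \<in> assumption_set MM E W C) \<and> w \<in> S"
      using assm conds by blast
  qed
qed

theorem theorem1:
  fixes N T :: nat
    and m n :: "nat \<Rightarrow> nat"
    and E :: "nat set set"
    and M S_loc :: "nat \<Rightarrow> behavior set"
    and S :: "(nat \<Rightarrow> behavior) set"
    and W :: "nat \<Rightarrow> nat \<Rightarrow> behavior set"
    and P :: "nat set set"
  defines "I \<equiv> {1..N}"
  defines "MM \<equiv> (\<Pi>\<^sub>E i\<in>I. M i)"
  assumes "simple_graph I E"
    and "\<And>i. i \<in> I \<Longrightarrow> M i \<subseteq> behavior_space T (m i) (n i)"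
    and "\<And>i. i \<in> I \<Longrightarrow> S_loc i \<subseteq> M i"
    and "S \<subseteq> MM"
    and "\<And>i j. i \<in> I \<Longrightarrow> j \<in> neighbors E i \<Longrightarrow> W i j \<subseteq> behavior_space T (m j) (n j)"
    and "\<And>i. i \<in> I \<Longrightarrow> S_loc i \<noteq> {}"
    and "coalition_partition I E P"
  shows "contract_refines (compose_contracts MM P (coalition_contract MM E W S_loc)) (MM, S) \<longleftrightarrow>
      (\<forall>C\<in>P. \<forall>j\<in>coalition_neighbors E C. S_loc j \<subseteq> coalition_assm E W C j) \<and>
      acyclic (assumption_edges M E W P) \<and>
      (\<Pi>\<^sub>E i\<in>I. S_loc i) \<subseteq> S"
proof -
  have "partition_on I P"
    using assms(9) by (simp add: coalition_partition_def)
  moreover have "finite I"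
    by (simp add: I_def)
  ultimately show ?thesis
    unfolding MM_def using assms(3,5,8) by (intro composition_refines_global_iff)
qed

end
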